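(* Let $\beta<1$ be real and let $f(z)=z+\sum_{n=2}^{\infty}a_nz^n\in\mathcal{F}_1(\beta)$. Then for all integers $n,m\ge2$ and all real $$\mu\ge\max\left\{\frac{nm}{(n+m-1)(1-\beta)},\ \frac{nm}{n+m-1}\right\},$$ we have $$|\mu a_na_m-a_{n+m-1}|\le\mu B_nB_m-B_{n+m-1},$$ where $B_n=\dfrac{1+2(n-1)(1-\beta)}{n}$ for $n\ge2$. The inequality is sharp: for every such $\beta,n,m,\mu$, equality is attained by some function in $\mathcal{F}_1(\beta)$.
   Context: $\mathbb{D}$ is the open unit disc and $\mathcal{A}$ is the class of analytic functions on $\mathbb{D}$ of the form $f(z)=z+a_2z^2+a_3z^3+\cdots$. For real $\beta<1$, $\mathcal{F}_1(\beta)$ is the class of $f\in\mathcal{A}$ with $\operatorname{Re}\big((1-z)f'(z)\big)>\beta$ for all $z\in\mathbb{D}$. *)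

theory Defs
  imports "HOL-Complex_Analysis.Complex_Analysis"
begin

abbreviation unit_disc :: "complex set"
  where "unit_disc \<equiv> ball 0 1"

text \<open>
  \<open>normalized_expansion f a\<close> says that \<open>f z = z + a 2 * z ^ 2 + a 3 * z ^ 3 + \<dots>\<close> on the unit disc.
  The values \<open>a 0\<close> and \<open>a 1\<close> play no role.
\<close>

definition normalized_expansion :: "(complex \<Rightarrow> complex) \<Rightarrow> (nat \<Rightarrow> complex) \<Rightarrow> bool"
  where "normalized_expansion f a \<longleftrightarrow>
    (\<forall>z\<in>unit_disc. (\<lambda>k. a (k + 2) * z ^ (k + 2)) sums (f z - z))"

definition class_A :: "(complex \<Rightarrow> complex) set"
  where "class_A = {f. f analytic_on unit_disc \<and> (\<exists>a. normalized_expansion f a)}"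

definition class_F1 :: "real \<Rightarrow> (complex \<Rightarrow> complex) set"
  where "class_F1 \<beta> = {f \<in> class_A. \<forall>z\<in>unit_disc. Re ((1 - z) * deriv f z) > \<beta>}"

definition B :: "real \<Rightarrow> nat \<Rightarrow> real"
  where "B \<beta> n = (1 + 2 * (real n - 1) * (1 - \<beta>)) / real n"

end

theory Submission
  imports Defs
begin

text \<open>
  For \<open>f \<in> class_F1 \<beta>\<close> put \<open>\<kappa> = 1 - \<beta>\<close>. The function \<open>p z = ((1 - z) * deriv f z - \<beta>) / \<kappa>\<close>
  has positive real part and \<open>p 0 = 1\<close>, so it is a Caratheodory function
  \<open>p z = 1 + c 1 * z + c 2 * z ^ 2 + \<dots>\<close>. Dividing by \<open>1 - z\<close> turns coefficients into partial sums:
  \<open>n * a n = 1 + \<kappa> * (c 1 + \<dots> + c (n - 1))\<close> (lemma \<open>F1_caratheodory_coeffs\<close>), and \<open>n * B \<beta> n\<close> is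
  what this becomes when every \<open>c k\<close> is replaced by \<open>2\<close>.

  Write \<open>N = n - 1\<close>, \<open>M = m - 1\<close> and \<open>\<nu> = \<mu> * (n + m - 1) / (n * m)\<close>. The assumption on \<open>\<mu>\<close> says exactly
  that \<open>\<nu> \<ge> 1\<close> and \<open>\<nu> * \<kappa> \<ge> 1\<close>. After multiplication by \<open>n + m - 1\<close> the functional is
  \<open>\<nu> * (1 + \<kappa> * A) * (1 + \<kappa> * C) - (1 + \<kappa> * S)\<close>, where \<open>A\<close>, \<open>C\<close>, \<open>S\<close> are the sums of
  \<open>c 1, c 2, \<dots>\<close> up to the indices \<open>N\<close>, \<open>M\<close>, \<open>N + M\<close>. Split \<open>S\<close> into \<open>C\<close> and the terms \<open>c (j + M)\<close> for
  \<open>j \<le> N\<close>. The part \<open>C\<close> is absorbed by \<open>\<nu> * \<kappa> * C\<close>, because \<open>\<nu> \<ge> 1\<close>. The term \<open>c (j + M)\<close> is paired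
  with the product \<open>c j * c M\<close> from \<open>A * C\<close>, whose coefficient is large enough because \<open>\<nu> * \<kappa> \<ge> 1\<close>.
  What remains is a combination, with nonnegative coefficients, of \<open>1\<close>, of the \<open>c k\<close>, of products
  \<open>c j * c k\<close> and of differences \<open>c j * c M - c (j + M)\<close> (lemma \<open>coeff_sum_bound\<close>). Each of these is
  largest in modulus when all \<open>c k\<close> equal \<open>2\<close>, by the two classical inequalities \<open>\<bar>c k\<bar> \<le> 2\<close> of
  Caratheodory (\<open>coeff_bound\<close>) and \<open>\<bar>c j * c k - c (j + k)\<bar> \<le> 2\<close> of Livingston (\<open>livingston_bound\<close>).

  Both inequalities come from one duality principle (\<open>dual_positivity\<close>): a trigonometric
  polynomial with nonnegative real part, averaged against the positive boundary measure of \<open>p\<close>, gives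
  a number with nonnegative real part. Squared moduli \<open>\<bar>1 - \<theta> * (c j - w ^ j) * w ^ k\<bar>\<^sup>2\<close> are the
  test polynomials that prove Livingston's inequality.

  Equality holds for the function whose \<open>p\<close> is \<open>(1 + z) / (1 - z)\<close>, where every \<open>c k\<close> with
  \<open>k > 0\<close> is \<open>2\<close>.
\<close>

section \<open>Coefficients as averages over a circle\<close>


lemma powser_coeff_deriv:
  fixes p :: "complex \<Rightarrow> complex"
  assumes "\<And>z. cmod z < 1 \<Longrightarrow> (\<lambda>k. c k * z ^ k) sums p z"
  shows "c k = (deriv ^^ k) p 0 / fact k"
proof -
  have "summable (\<lambda>k. c k * (1/2) ^ k)"
    using assms[of "1/2"] by (simp add: sums_iff)
  then have "ereal (cmod (1/2)) \<le> conv_radius c"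
    by (rule conv_radius_geI)
  then have "fps_conv_radius (Abs_fps c) > 0"
    unfolding fps_conv_radius_def
    by (simp add: fps_nth_Abs_fps) (metis dual_order.strict_trans1 ereal_less(2) half_gt_zero_iff less_numeral_extra(1))
  moreover have "eventually (\<lambda>z. z \<in> ball 0 1) (nhds (0::complex))"
    by (intro eventually_nhds_in_open) auto
  then have "eventually (\<lambda>z. eval_fps (Abs_fps c) z = p z) (nhds 0)"
    by eventually_elim (use assms in \<open>auto simp: eval_fps_def sums_iff\<close>)
  ultimately have "p has_fps_expansion Abs_fps c"
    by (simp add: has_fps_expansion_def)
  from fps_nth_fps_expansion[OF this, of k] show ?thesis by simp
qed

text \<open>
  Cauchy's formula for the \<open>k\<close>-th derivative, parametrised by the angle. The average is taken over
  \<open>[0, 1]\<close>, so no factor \<open>2 * pi\<close> appears.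
\<close>

lemma circle_mean_powser:
  fixes p :: "complex \<Rightarrow> complex"
  assumes ser: "\<And>z. cmod z < 1 \<Longrightarrow> (\<lambda>k. c k * z ^ k) sums p z" and r: "0 < r" "r < 1"
  shows "((\<lambda>x. p (of_real r * cis (2 * pi * x)) / cis (2 * pi * x) ^ k)
            has_integral c k * of_real r ^ k) {0..1}"
proof -
  have hol: "p holomorphic_on ball 0 1"
    by (rule power_series_holomorphic[of _ _ c]) (use ser in auto)
  have "((\<lambda>u. p u / (u - 0) ^ Suc k) has_contour_integral
      (2 * pi * \<i>) / fact k * (deriv ^^ k) p 0) (circlepath 0 r)"
  proof (rule Cauchy_has_contour_integral_higher_derivative_circlepath)
    show "continuous_on (cball 0 r) p"
      using r by (intro holomorphic_on_imp_continuous_on holomorphic_on_subset[OF hol]) auto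
    show "p holomorphic_on ball 0 r"
      using r by (intro holomorphic_on_subset[OF hol]) auto
  qed (use r in auto)
  then have "((\<lambda>u. p u / u ^ Suc k) has_contour_integral (2 * pi * \<i>) * c k) (circlepath 0 r)"
    by (simp add: powser_coeff_deriv[OF ser, of k])
  then have "((\<lambda>x. p (of_real r * cis (2 * pi * x)) / (of_real r * cis (2 * pi * x)) ^ Suc k *
      (2 * pi * \<i> * r * cis (2 * pi * x))) has_integral (2 * pi * \<i>) * c k) {0..1}"
    unfolding has_contour_integral vector_derivative_circlepath
    by (simp add: circlepath cis_conv_exp mult_ac)
  from has_integral_mult_left[OF this, of "of_real r ^ k / (2 * pi * \<i>)"]
  show ?thesis
    using r by (simp add: field_simps power_mult_distrib)
qed

section \<open>Caratheodory functions\<close>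

text \<open>This reduces the bounds for moduli below to bounds for real parts, which are linear.\<close>

lemma cmod_le_if_Re_rotations_le:
  assumes "\<And>\<theta>. cmod \<theta> = 1 \<Longrightarrow> Re (\<theta> * d) \<le> K"
  shows "cmod d \<le> K"
proof (cases "d = 0")
  case True
  then show ?thesis using assms[of 1] by simp
next
  case False
  have "cnj d / cmod d * d = cmod d"
    using False by (simp add: complex_norm_square[symmetric] power2_eq_square mult.commute)
  then show ?thesis
    using assms[of "cnj d / cmod d"] False by (simp add: norm_divide)
qed

text \<open>
  Since \<open>p 0 = 1\<close>, the weak inequality for the real part already implies the strict one, by the open
  mapping theorem.
\<close>

locale caratheodory_function =
  fixes c :: "nat \<Rightarrow> complex" and p :: "complex \<Rightarrow> complex"
  assumes ser: "\<And>z. cmod z < 1 \<Longrightarrow> (\<lambda>k. c k * z ^ k) sums p z"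
    and c0: "c 0 = 1"
    and pos: "\<And>z. cmod z < 1 \<Longrightarrow> 0 \<le> Re (p z)"
begin

text \<open>
  On the circle of radius \<open>r\<close>, the mean of \<open>2 * Re (p z) * T (cnj w)\<close> with \<open>z = r * w\<close> and \<open>T\<close> the polynomial with
  coefficients \<open>b\<close> has nonnegative real part. Since \<open>2 * Re (p z) = p z + cnj (p z)\<close>, this mean is a
  sum of two: the first picks out \<open>b k * c k * r ^ k\<close>, and in the second only the
  constant term \<open>b 0\<close> survives, because \<open>p\<close> has no negative powers. Then \<open>r\<close> tends to \<open>1\<close>. The term \<open>b 0\<close>
  thus occurs twice in the conclusion: alone and, as \<open>b 0 * c 0\<close>, inside the sum.
\<close>

lemma dual_positivity:
  assumes T: "\<And>w. cmod w = 1 \<Longrightarrow> 0 \<le> Re (\<Sum>k\<le>N. b k * w ^ k)"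
  shows "0 \<le> Re (b 0 + (\<Sum>k\<le>N. b k * c k))"
proof -
  have *: "0 \<le> Re (b 0 + (\<Sum>k\<le>N. b k * (c k * of_real r ^ k)))" if r: "0 < r" "r < 1" for r :: real
  proof -
    define w where "w x = cis (2 * pi * x)" for x :: real
    have w: "cmod (w x) = 1" "w x \<noteq> 0" "inverse (w x) = cnj (w x)" for x
      by (simp_all add: w_def cis_cnj)
    have I1: "((\<lambda>x. p (of_real r * w x) / w x ^ k) has_integral c k * of_real r ^ k) {0..1}" for k
      unfolding w_def by (rule circle_mean_powser[OF ser r])
    have I2: "((\<lambda>x. p (of_real r * w x) * w x ^ k) has_integral (if k = 0 then 1 else 0)) {0..1}" for k
    proof -
      \<comment> \<open>the mean of \<open>p z * z ^ k\<close> is the constant coefficient of a shifted series\<close>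
      define d where "d i = (if i < k then 0 else c (i - k))" for i
      have "(\<lambda>i. d i * z ^ i) sums (p z * z ^ k)" if z: "cmod z < 1" for z
      proof -
        have "(\<lambda>i. d (i + k) * z ^ (i + k)) sums (p z * z ^ k)"
          using sums_mult2[OF ser[OF z], of "z ^ k"] by (simp add: d_def power_add mult_ac)
        moreover have "(\<Sum>i<k. d i * z ^ i) = 0" by (simp add: d_def)
        ultimately show ?thesis
          using sums_iff_shift'[of "\<lambda>i. d i * z ^ i" k "p z * z ^ k"] by simp
      qed
      from circle_mean_powser[OF this r, of 0]
      have "((\<lambda>x. p (of_real r * w x) * (of_real r * w x) ^ k) has_integral d 0) {0..1}"
        by (simp add: w_def)
      from has_integral_mult_left[OF this, of "1 / of_real r ^ k"]
      show ?thesis using r by (simp add: d_def c0 power_mult_distrib split: if_splits)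
    qed
    have I3: "((\<lambda>x. cnj (p (of_real r * w x)) / w x ^ k) has_integral (if k = 0 then 1 else 0)) {0..1}" for k
    proof -
      have "((\<lambda>x. cnj (p (of_real r * w x) * w x ^ k)) has_integral cnj (if k = 0 then 1 else 0)) {0..1}"
        using has_integral_linear[OF I2 bounded_linear_cnj] by (simp add: o_def)
      then show ?thesis by (simp add: divide_inverse power_inverse[symmetric] w(3) if_distrib cong: if_cong)
    qed
    have "((\<lambda>x. \<Sum>k\<le>N. b k * (p (of_real r * w x) / w x ^ k + cnj (p (of_real r * w x)) / w x ^ k))
        has_integral (\<Sum>k\<le>N. b k * (c k * of_real r ^ k + (if k = 0 then 1 else 0)))) {0..1}"
      by (intro has_integral_sum has_integral_mult_right has_integral_add I1 I3) auto
    also have "(\<lambda>x. \<Sum>k\<le>N. b k * (p (of_real r * w x) / w x ^ k + cnj (p (of_real r * w x)) / w x ^ k))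
       = (\<lambda>x. of_real (2 * Re (p (of_real r * w x))) * (\<Sum>k\<le>N. b k * (cnj (w x)) ^ k))"
      unfolding complex_add_cnj[symmetric]
      by (simp add: sum_distrib_left sum.distrib divide_inverse power_inverse[symmetric] w(3) algebra_simps)
    also have "(\<Sum>k\<le>N. b k * (c k * of_real r ^ k + (if k = 0 then 1 else 0)))
       = b 0 + (\<Sum>k\<le>N. b k * (c k * of_real r ^ k))"
    proof -
      have "(\<Sum>k\<le>N. b k * (if k = 0 then 1 else 0)) = (\<Sum>k\<le>N. if k = 0 then b 0 else 0)"
        by (intro sum.cong) auto
      then show ?thesis by (simp only: distrib_left sum.distrib) simp
    qed
    finally have I: "((\<lambda>x. of_real (2 * Re (p (of_real r * w x))) * (\<Sum>k\<le>N. b k * (cnj (w x)) ^ k))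
        has_integral b 0 + (\<Sum>k\<le>N. b k * (c k * of_real r ^ k))) {0..1}" .
    have "((\<lambda>x. Re (of_real (2 * Re (p (of_real r * w x))) * (\<Sum>k\<le>N. b k * (cnj (w x)) ^ k)))
        has_integral Re (b 0 + (\<Sum>k\<le>N. b k * (c k * of_real r ^ k)))) {0..1}"
      using has_integral_linear[OF I bounded_linear_Re] by (simp only: o_def)
    then show ?thesis
    proof (rule has_integral_nonneg)
      fix x :: real
      have "0 \<le> Re (p (of_real r * w x))" using r by (intro pos) (simp add: norm_mult w)
      moreover have "0 \<le> Re (\<Sum>k\<le>N. b k * (cnj (w x)) ^ k)" by (intro T) (simp add: w)
      ultimately show "0 \<le> Re (of_real (2 * Re (p (of_real r * w x))) * (\<Sum>k\<le>N. b k * (cnj (w x)) ^ k))"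
        by simp
    qed
  qed
  have "((\<lambda>r. Re (b 0 + (\<Sum>k\<le>N. b k * (c k * of_real r ^ k)))) \<longlongrightarrow>
      Re (b 0 + (\<Sum>k\<le>N. b k * (c k * of_real 1 ^ k)))) (at_left (1::real))"
    by (intro tendsto_intros)
  moreover have "\<forall>\<^sub>F r in at_left (1::real). 0 \<le> Re (b 0 + (\<Sum>k\<le>N. b k * (c k * of_real r ^ k)))"
  proof (rule eventually_mono)
    show "\<forall>\<^sub>F r in at_left 1. r \<in> {0<..<1::real}"
      by (rule eventually_at_left_real) simp
  qed (rule *, auto)
  ultimately show ?thesis
    using tendsto_lowerbound by fastforce
qed


text \<open>The test polynomial is \<open>1 - \<theta> * w ^ n\<close>.\<close>

lemma coeff_bound:
  assumes n: "0 < n"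
  shows "cmod (c n) \<le> 2"
proof (rule cmod_le_if_Re_rotations_le)
  fix \<theta> :: complex assume \<theta>: "cmod \<theta> = 1"
  define b where "b k = (if k = 0 then 1 else 0) - (if k = n then \<theta> else 0)" for k
  have b: "(\<Sum>k\<le>n. b k * v k) = v 0 - \<theta> * v n" for v
    by (simp add: b_def left_diff_distrib sum_subtractf if_distrib[of "\<lambda>x. x * _"] cong: if_cong)
  have "0 \<le> Re (b 0 + (\<Sum>k\<le>n. b k * c k))"
  proof (rule dual_positivity)
    fix w :: complex assume "cmod w = 1"
    with \<theta> have "cmod (\<theta> * w ^ n) = 1" by (simp add: norm_mult norm_power)
    then show "0 \<le> Re (\<Sum>k\<le>n. b k * w ^ k)"
      unfolding b using complex_Re_le_cmod[of "\<theta> * w ^ n"] by simp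
  qed
  then show "Re (\<theta> * c n) \<le> 2"
    unfolding b using n by (simp add: b_def c0)
qed

text \<open>
  The test polynomial is the square of \<open>\<bar>1 - \<theta> * w ^ m * (c n - w ^ n)\<bar>\<close> on the unit circle. After
  expansion, the terms in \<open>cnj w\<close> are replaced by their conjugates, which does not change the real
  part and leaves a polynomial in \<open>w\<close>. In the average \<open>\<bar>c n\<bar>\<^sup>2\<close> cancels: with respect to the probability
  measure of \<open>p\<close>, the function \<open>c n - w ^ n\<close> has second moment \<open>1\<close> whatever \<open>c n\<close> is, since \<open>w ^ n\<close> has
  mean \<open>c n / 2\<close>.
\<close>

lemma livingston_bound:
  assumes n: "0 < n" and m: "0 < m"
  shows "cmod (c n * c m - c (n + m)) \<le> 2"
proof (rule cmod_le_if_Re_rotations_le)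
  fix \<theta> :: complex assume \<theta>: "cmod \<theta> = 1"
  \<comment> \<open>The summands are added because \<open>n\<close> and \<open>m\<close> may be equal.\<close>
  define b where "b k = (if k = 0 then of_real (2 + (cmod (c n))\<^sup>2) else 0)
      + ((if k = m then - 2 * \<theta> * c n else 0)
      + ((if k = n + m then 2 * \<theta> else 0) + (if k = n then - 2 * cnj (c n) else 0)))" for k
  have b: "(\<Sum>k\<le>n + m. b k * v k) = of_real (2 + (cmod (c n))\<^sup>2) * v 0 - 2 * \<theta> * c n * v m
      + 2 * \<theta> * v (n + m) - 2 * cnj (c n) * v n" for v
    by (simp add: b_def distrib_right sum.distrib if_distrib[of "\<lambda>x. x * _"] cong: if_cong)
  have "0 \<le> Re (b 0 + (\<Sum>k\<le>n + m. b k * c k))"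
  proof (rule dual_positivity)
    fix w :: complex assume w: "cmod w = 1"
    define u where "u = \<theta> * w ^ m"
    have u: "cmod u = 1" "cmod (w ^ n) = 1" using w \<theta> by (simp_all add: u_def norm_mult norm_power)
    have "(\<Sum>k\<le>n + m. b k * w ^ k)
        = of_real (2 + (cmod (c n))\<^sup>2) - 2 * u * (c n - w ^ n) - 2 * cnj (c n) * w ^ n"
      unfolding b by (simp add: u_def power_add algebra_simps)
    moreover have "Re (of_real (2 + (cmod (c n))\<^sup>2) - 2 * u * (c n - w ^ n) - 2 * cnj (c n) * w ^ n)
        = (cmod (1 - u * (c n - w ^ n)))\<^sup>2"
    proof -
      have "(cmod (1 - u * (c n - w ^ n)))\<^sup>2
          = 1 - 2 * Re (u * (c n - w ^ n)) + (cmod (c n - w ^ n))\<^sup>2"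
      proof -
        have "(cmod (1 - v))\<^sup>2 = 1 - 2 * Re v + (cmod v)\<^sup>2" for v
          unfolding cmod_power2 by (simp add: power2_eq_square algebra_simps)
        then show ?thesis using u by (simp add: norm_mult)
      qed
      also have "(cmod (c n - w ^ n))\<^sup>2 = (cmod (c n))\<^sup>2 - 2 * Re (cnj (c n) * w ^ n) + (cmod (w ^ n))\<^sup>2"
        unfolding cmod_power2 by (simp add: power2_eq_square algebra_simps)
      finally show ?thesis using u by simp
    qed
    ultimately show "0 \<le> Re (\<Sum>k\<le>n + m. b k * w ^ k)" by simp
  qed
  moreover have "b 0 + (\<Sum>k\<le>n + m. b k * c k)
      = of_real 4 - 2 * (\<theta> * (c n * c m - c (n + m)))"
  proof -
    have "b 0 = of_real (2 + (cmod (c n))\<^sup>2)" using n m by (simp add: b_def)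
    moreover have "cnj (c n) * c n = of_real ((cmod (c n))\<^sup>2)"
      by (simp only: complex_norm_square mult.commute)
    ultimately show ?thesis unfolding b by (simp add: c0 algebra_simps)
  qed
  ultimately show "Re (\<theta> * (c n * c m - c (n + m))) \<le> 2" by simp
qed

end

section \<open>The inequality for partial sums\<close>

text \<open>
  The upper limit of the second sum is a successor so that its last term \<open>c (Suc M)\<close> can be split off;
  this term is the partner of every \<open>c j\<close> in the products that compensate \<open>c (j + Suc M)\<close>. All
  estimates are equalities when every \<open>c k\<close> is \<open>2\<close>, so the bound is the value at that point.
\<close>

lemma coeff_sum_bound:
  fixes c :: "nat \<Rightarrow> complex" and \<kappa> \<nu> :: real
  assumes c: "\<And>k. 0 < k \<Longrightarrow> cmod (c k) \<le> 2"
    and cc: "\<And>j k. 0 < j \<Longrightarrow> 0 < k \<Longrightarrow> cmod (c j * c k - c (j + k)) \<le> 2"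
    and \<kappa>: "0 < \<kappa>" and \<nu>: "1 \<le> \<nu>" "1 \<le> \<nu> * \<kappa>"
  shows "cmod (of_real \<nu> * (1 + of_real \<kappa> * (\<Sum>j=1..N. c j)) * (1 + of_real \<kappa> * (\<Sum>k=1..Suc M. c k))
           - (1 + of_real \<kappa> * (\<Sum>k=1..N + Suc M. c k)))
       \<le> \<nu> * (1 + 2 * real N * \<kappa>) * (1 + 2 * real (Suc M) * \<kappa>) - (1 + 2 * real (N + Suc M) * \<kappa>)"
proof -
  define A where "A = (\<Sum>j=1..N. c j)"
  define C where "C = (\<Sum>k=1..Suc M. c k)"
  define D where "D = (\<Sum>j=1..N. of_real (\<nu> * \<kappa>) * c j * c (Suc M) - c (j + Suc M))"
  define E where "E = (\<Sum>k=1..M. c k)"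
  have sum_le: "cmod (\<Sum>j=1..K. c j) \<le> 2 * real K" for K
    using sum_norm_bound[of "{1..K}" c 2] c by simp
  have C: "C = E + c (Suc M)" by (simp add: C_def E_def)
  have split: "(\<Sum>k=1..N + Suc M. c k) = C + (\<Sum>j=1..N. c (j + Suc M))"
    by (induction N) (simp_all add: C_def)
  have D: "D = of_real (\<nu> * \<kappa>) * A * c (Suc M) - (\<Sum>j=1..N. c (j + Suc M))"
    by (simp add: D_def A_def sum_subtractf sum_distrib_left sum_distrib_right)
  have A_le: "cmod A \<le> 2 * real N" and C_le: "cmod C \<le> 2 * real (Suc M)" and E_le: "cmod E \<le> 2 * real M"
    unfolding A_def C_def E_def by (rule sum_le)+
  have D_le: "cmod D \<le> real N * (4 * (\<nu> * \<kappa>) - 2)"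
  proof -
    have "cmod (of_real (\<nu> * \<kappa>) * c j * c (Suc M) - c (j + Suc M)) \<le> 4 * (\<nu> * \<kappa>) - 2" if "0 < j" for j
    proof -
      have "of_real (\<nu> * \<kappa>) * c j * c (Suc M) - c (j + Suc M)
          = of_real (\<nu> * \<kappa> - 1) * (c j * c (Suc M)) + (c j * c (Suc M) - c (j + Suc M))"
        by (simp add: algebra_simps)
      also have "cmod \<dots> \<le> (\<nu> * \<kappa> - 1) * (2 * 2) + 2"
      proof (intro norm_triangle_mono cc that)
        show "cmod (of_real (\<nu> * \<kappa> - 1) * (c j * c (Suc M))) \<le> (\<nu> * \<kappa> - 1) * (2 * 2)"
          unfolding norm_mult norm_of_real using \<nu> that by (intro mult_mono c) auto
      qed simp
      finally show ?thesis by simp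
    qed
    then show ?thesis
      unfolding D_def using sum_norm_bound[of "{1..N}" "\<lambda>j. of_real (\<nu> * \<kappa>) * c j * c (Suc M) - c (j + Suc M)"] by simp
  qed
  \<comment> \<open>every coefficient on the right is nonnegative, so the triangle inequality is sharp if all \<open>c k\<close> are \<open>2\<close>\<close>
  have "of_real \<nu> * (1 + of_real \<kappa> * A) * (1 + of_real \<kappa> * C)
           - (1 + of_real \<kappa> * (\<Sum>k=1..N + Suc M. c k))
      = of_real (\<nu> - 1) + of_real (\<nu> * \<kappa>) * A + of_real ((\<nu> - 1) * \<kappa>) * C
        + of_real (\<nu> * \<kappa> * \<kappa>) * (A * E) + of_real \<kappa> * D"
    unfolding split D C by (simp add: algebra_simps)
  also have "cmod \<dots> \<le> (\<nu> - 1) + \<nu> * \<kappa> * (2 * real N) + (\<nu> - 1) * \<kappa> * (2 * real (Suc M))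
        + \<nu> * \<kappa> * \<kappa> * ((2 * real N) * (2 * real M)) + \<kappa> * (real N * (4 * (\<nu> * \<kappa>) - 2))"
  proof (intro norm_triangle_mono)
    show "cmod (of_real (\<nu> - 1)) \<le> \<nu> - 1" using \<nu> by (simp only: norm_of_real) 
    show "cmod (of_real (\<nu> * \<kappa>) * A) \<le> \<nu> * \<kappa> * (2 * real N)"
      unfolding norm_mult norm_of_real using \<nu> by (intro mult_mono A_le) auto
    show "cmod (of_real ((\<nu> - 1) * \<kappa>) * C) \<le> (\<nu> - 1) * \<kappa> * (2 * real (Suc M))"
      unfolding norm_mult norm_of_real using \<nu> \<kappa> by (intro mult_mono C_le) (auto simp: abs_mult)
    show "cmod (of_real (\<nu> * \<kappa> * \<kappa>) * (A * E)) \<le> \<nu> * \<kappa> * \<kappa> * ((2 * real N) * (2 * real M))"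
      unfolding norm_mult norm_of_real using \<nu> \<kappa>
      by (intro mult_mono A_le E_le) (auto simp: abs_mult)
    show "cmod (of_real \<kappa> * D) \<le> \<kappa> * (real N * (4 * (\<nu> * \<kappa>) - 2))"
      unfolding norm_mult norm_of_real using \<kappa> by (intro mult_mono D_le) auto
  qed
  also have "\<dots> = \<nu> * (1 + 2 * real N * \<kappa>) * (1 + 2 * real (Suc M) * \<kappa>) - (1 + 2 * real (N + Suc M) * \<kappa>)"
    by (simp add: algebra_simps)
  finally show ?thesis by (simp only: A_def C_def)
qed

section \<open>The coefficient functional\<close>

text \<open>
  The Taylor coefficients of \<open>(1 - z) * deriv f z\<close> are the differences of consecutive \<open>n * a n\<close>, so
  that \<open>n * a n\<close> is recovered by telescoping.
\<close>

lemma F1_caratheodory_coeffs: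
  assumes \<beta>: "\<beta> < 1" and f: "f \<in> class_F1 \<beta>" and fa: "normalized_expansion f a"
  obtains c p where "caratheodory_function c p"
    "\<And>n. 2 \<le> n \<Longrightarrow> of_nat n * a n = 1 + of_real (1 - \<beta>) * (\<Sum>k=1..n-1. c k)"
proof -
  \<comment> \<open>\<open>a 0\<close> and \<open>a 1\<close> are arbitrary numbers; \<open>e\<close> has the Taylor coefficients of \<open>f\<close> in their place\<close>
  define e where "e k = (if k = 0 then 0 else if k = 1 then 1 else a k)" for k
  define d where "d = diffs e"
  define h where "h k = (if k = 0 then 1 else d k - d (k - 1))" for k
  define c where "c k = (if k = 0 then 1 else h k / of_real (1 - \<beta>))" for k
  define p where "p z = ((1 - z) * deriv f z - of_real \<beta>) / of_real (1 - \<beta>)" for z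
  have e: "(\<lambda>k. e k * z ^ k) sums f z" if z: "cmod z < 1" for z
  proof -
    have "(\<lambda>k. e (k + 2) * z ^ (k + 2)) sums (f z - z)"
      using fa z by (simp add: normalized_expansion_def e_def)
    moreover have "(\<Sum>k<2. e k * z ^ k) = z" by (simp add: e_def numeral_2_eq_2)
    ultimately show ?thesis
      using sums_iff_shift[of "\<lambda>k. e k * z ^ k" 2 "f z - z"] by simp
  qed
  have d0: "d 0 = 1" by (simp add: d_def diffs_def e_def)
  have d: "(\<lambda>k. d k * z ^ k) sums deriv f z" if z: "cmod z < 1" for z
    unfolding d_def
  proof (rule termdiffs_sums_strong[OF e _ z])
    have "f analytic_on {z}"
      using f z by (auto simp: class_F1_def class_A_def intro: analytic_on_subset)
    then show "(f has_field_derivative deriv f z) (at z)"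
      using DERIV_deriv_iff_field_differentiable analytic_on_imp_differentiable_at by blast
  qed
  have h: "(\<lambda>k. h k * z ^ k) sums ((1 - z) * deriv f z)" if z: "cmod z < 1" for z
  proof -
    have "(\<lambda>k. (if Suc k = 0 then 0 else d (Suc k - 1)) * z ^ Suc k) sums (z * deriv f z)"
      using sums_mult[OF d[OF z], of z] by (simp add: mult_ac)
    then have "(\<lambda>k. (if k = 0 then 0 else d (k - 1)) * z ^ k) sums (z * deriv f z)"
      by (subst (asm) sums_Suc_iff) simp
    from sums_diff[OF d[OF z] this]
    have "(\<lambda>k. d k * z ^ k - (if k = 0 then 0 else d (k - 1)) * z ^ k) sums ((1 - z) * deriv f z)"
      by (simp add: left_diff_distrib)
    then show ?thesis
      by (rule back_subst[where P = "\<lambda>F. F sums _"]) (auto simp: h_def d0 left_diff_distrib fun_eq_iff)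
  qed
  have "caratheodory_function c p"
  proof
    fix z :: complex assume z: "cmod z < 1"
    have "(\<lambda>k. (if k = 0 then of_real \<beta> else 0) * z ^ k) sums of_real \<beta>"
      using sums_mult[OF powser_sums_if[of 0 z], of "of_real \<beta>"]
      by (simp add: if_distrib[of "\<lambda>x. x * _"] if_distrib[of "\<lambda>x. _ * x"] cong: if_cong)
    from sums_divide[OF sums_diff[OF h[OF z] this], of "of_real (1 - \<beta>)"]
    show "(\<lambda>k. c k * z ^ k) sums p z"
      unfolding p_def
      by (rule back_subst[where P = "\<lambda>F. F sums _"])
         (use \<beta> in \<open>auto simp: c_def h_def field_simps fun_eq_iff\<close>)
    have "\<beta> < Re ((1 - z) * deriv f z)" using f z by (auto simp: class_F1_def)
    then show "0 \<le> Re (p z)"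
      using \<beta> unfolding p_def Re_divide_of_real by simp
  qed (simp add: c_def)
  moreover have "of_nat n * a n = 1 + of_real (1 - \<beta>) * (\<Sum>k=1..n-1. c k)" if n: "2 \<le> n" for n
  proof -
    have "d N = 1 + (\<Sum>k=1..N. h k)" for N
      by (induction N) (auto simp: d0 h_def)
    also have "(\<Sum>k=1..N. h k) = of_real (1 - \<beta>) * (\<Sum>k=1..N. c k)" for N
      using \<beta> by (auto simp: sum_distrib_left c_def intro!: sum.cong)
    finally have "d (n - 1) = 1 + of_real (1 - \<beta>) * (\<Sum>k=1..n-1. c k)" .
    moreover have "d (n - 1) = of_nat n * a n"
      using n by (simp add: d_def diffs_def e_def of_nat_diff)
    ultimately show ?thesis by simp
  qed
  ultimately show ?thesis by (rule that)
qed

lemma F1_functional_bound: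
  fixes \<beta> \<mu> :: real and n m :: nat
  assumes \<beta>: "\<beta> < 1" and n: "n \<ge> 2" and m: "m \<ge> 2"
    and \<mu>: "\<mu> \<ge> max (real n * real m / ((real n + real m - 1) * (1 - \<beta>)))
                  (real n * real m / (real n + real m - 1))"
    and f: "f \<in> class_F1 \<beta>" and fa: "normalized_expansion f a"
  shows "cmod (of_real \<mu> * a n * a m - a (n + m - 1)) \<le> \<mu> * B \<beta> n * B \<beta> m - B \<beta> (n + m - 1)"
proof -
  obtain c p where p: "caratheodory_function c p"
    and ac: "\<And>n. 2 \<le> n \<Longrightarrow> of_nat n * a n = 1 + of_real (1 - \<beta>) * (\<Sum>k=1..n-1. c k)"
    using F1_caratheodory_coeffs[OF \<beta> f fa] by metis
  define q where "q = real n + real m - 1"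
  define \<nu> where "\<nu> = \<mu> * q / (real n * real m)"
  have q: "q > 0" "q = real (n + m - 1)" using n m by (auto simp: q_def of_nat_diff)
  have \<nu>: "1 \<le> \<nu>" "1 \<le> \<nu> * (1 - \<beta>)"
    using \<mu> n m q(1) \<beta> unfolding q_def[symmetric] by (simp_all add: \<nu>_def field_simps)
  have \<mu>_eq: "\<mu> = \<nu> * (real n * real m) / q" using n m q(1) by (simp add: \<nu>_def)
  define X where "X = of_real \<nu> * (of_nat n * a n) * (of_nat m * a m) - of_nat (n + m - 1) * a (n + m - 1)"
  have "cmod X \<le> \<nu> * (real n * B \<beta> n) * (real m * B \<beta> m) - q * B \<beta> (n + m - 1)"
  proof -
    define N where "N = n - 1"
    define M where "M = m - 2"
    have nm: "n = Suc N" "m = Suc (Suc M)" using n m by (auto simp: N_def M_def)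
    have *: "of_nat n * a n = 1 + of_real (1 - \<beta>) * (\<Sum>k=1..N. c k)"
      "of_nat m * a m = 1 + of_real (1 - \<beta>) * (\<Sum>k=1..Suc M. c k)"
      "of_nat (n + m - 1) * a (n + m - 1) = 1 + of_real (1 - \<beta>) * (\<Sum>k=1..N + Suc M. c k)"
      using ac[of n] ac[of m] ac[of "n + m - 1"] n m by (auto simp: nm)
    have B: "real n * B \<beta> n = 1 + 2 * real N * (1 - \<beta>)"
      "real m * B \<beta> m = 1 + 2 * real (Suc M) * (1 - \<beta>)"
      "q * B \<beta> (n + m - 1) = 1 + 2 * real (N + Suc M) * (1 - \<beta>)"
      unfolding q B_def by (auto simp: nm)
    show ?thesis
      unfolding X_def * B
      by (rule coeff_sum_bound[OF caratheodory_function.coeff_bound[OF p]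
            caratheodory_function.livingston_bound[OF p]]) (use \<beta> \<nu> in auto)
  qed
  moreover have "of_real \<mu> * a n * a m - a (n + m - 1) = X / of_real q"
  proof -
    have "complex_of_nat (n + m - 1) = of_real q" unfolding q(2) by simp
    moreover have "complex_of_real \<mu> = of_real \<nu> * (of_nat n * of_nat m) / of_real q"
      unfolding \<mu>_eq by simp
    ultimately show ?thesis
      using q(1) unfolding X_def by (simp add: diff_divide_distrib mult_ac)
  qed
  moreover have "\<mu> * B \<beta> n * B \<beta> m - B \<beta> (n + m - 1)
      = (\<nu> * (real n * B \<beta> n) * (real m * B \<beta> m) - q * B \<beta> (n + m - 1)) / q"
    using q(1) unfolding \<mu>_eq by (simp add: field_simps)
  ultimately show ?thesis
    using q(1) by (simp add: norm_divide divide_right_mono)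
qed

section \<open>The extremal function\<close>

text \<open>
  This is the solution of \<open>(1 - z) * f' z = \<beta> + (1 - \<beta>) * (1 + z) / (1 - z)\<close> with \<open>f 0 = 0\<close>.
\<close>

definition F1_extremal :: "real \<Rightarrow> complex \<Rightarrow> complex"
  where "F1_extremal \<beta> z = of_real (2 * (1 - \<beta>)) * (z / (1 - z)) - of_real (1 - 2 * (1 - \<beta>)) * Ln (1 - z)"

lemma F1_extremal_expansion: "normalized_expansion (F1_extremal \<beta>) (\<lambda>n. of_real (B \<beta> n))"
  unfolding normalized_expansion_def
proof
  fix z :: complex assume "z \<in> unit_disc"
  then have z: "cmod z < 1" by simp
  let ?s = "2 * (1 - \<beta>)"
  have G: "(\<lambda>k. z ^ Suc k) sums (z / (1 - z))"
    using sums_mult[OF geometric_sums[OF z], of z] by simp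
  have "(\<lambda>k. - (z ^ k / of_nat k)) sums Ln (1 - z)"
    using Ln_series'[of "-z"] z by simp
  then have "(\<lambda>k. - (z ^ Suc k / of_nat (Suc k))) sums Ln (1 - z)"
    by (subst sums_Suc_iff) simp
  from sums_diff[OF sums_mult[OF G, of "of_real ?s"] sums_mult[OF this, of "of_real (1 - ?s)"]]
  have "(\<lambda>k. of_real ?s * z ^ Suc k - of_real (1 - ?s) * - (z ^ Suc k / of_nat (Suc k)))
     sums F1_extremal \<beta> z" by (simp only: F1_extremal_def)
  also have "(\<lambda>k. of_real ?s * z ^ Suc k - of_real (1 - ?s) * - (z ^ Suc k / of_nat (Suc k)))
      = (\<lambda>k. of_real (B \<beta> (Suc k)) * z ^ Suc k)"
    by (rule ext) (simp add: B_def field_simps del: of_nat_Suc)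
  finally have "(\<lambda>k. of_real (B \<beta> (Suc k)) * z ^ Suc k) sums F1_extremal \<beta> z" .
  then show "(\<lambda>k. of_real (B \<beta> (k + 2)) * z ^ (k + 2)) sums (F1_extremal \<beta> z - z)"
    using sums_Suc_iff[of "\<lambda>k. of_real (B \<beta> (Suc k)) * z ^ Suc k" "F1_extremal \<beta> z - z"]
    by (simp add: B_def)
qed

lemma F1_extremal_mem:
  assumes \<beta>: "\<beta> < 1"
  shows "F1_extremal \<beta> \<in> class_F1 \<beta>"
proof -
  have nonpos: "1 - z \<notin> \<real>\<^sub>\<le>\<^sub>0" "z \<noteq> 1" if "cmod z < 1" for z
    using that complex_Re_le_cmod[of z] by (auto simp: complex_nonpos_Reals_iff)
  have der: "(F1_extremal \<beta> has_field_derivative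
       of_real (2 * (1 - \<beta>)) * (1 / (1 - z)\<^sup>2) + of_real (1 - 2 * (1 - \<beta>)) / (1 - z)) (at z)"
    if z: "cmod z < 1" for z
    unfolding F1_extremal_def
    by (rule derivative_eq_intros refl | use nonpos[OF z] in \<open>simp add: field_simps power2_eq_square\<close>)+
  have "F1_extremal \<beta> holomorphic_on unit_disc"
    using der by (subst holomorphic_on_open) (auto, blast)
  then have "F1_extremal \<beta> \<in> class_A"
    using F1_extremal_expansion by (auto simp: class_A_def analytic_on_open)
  moreover have "\<beta> < Re ((1 - z) * deriv (F1_extremal \<beta>) z)" if z: "cmod z < 1" for z
  proof -
    have "(1 - z) * deriv (F1_extremal \<beta>) z = of_real \<beta> + of_real (1 - \<beta>) * (2 / (1 - z) - 1)"
    proof -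
      have "(1 - z) * (A * (1 / (1 - z)\<^sup>2) + C / (1 - z)) = A / (1 - z) + C" for A C :: complex
        using nonpos[OF z] by (simp add: distrib_left power2_eq_square)
      from this[of "of_real (2 * (1 - \<beta>))" "of_real (1 - 2 * (1 - \<beta>))"] show ?thesis
        unfolding DERIV_imp_deriv[OF der[OF z]]
        by (simp only:) (simp add: algebra_simps)
    qed
    moreover have "0 < Re (2 / (1 - z) - 1)"
    proof -
      have "2 / (1 - z) - 1 = (1 + z) / (1 - z)" using nonpos[OF z] by (simp add: field_simps)
      moreover have "(1 + z) * cnj (1 - z) = of_real (1 - (cmod z)\<^sup>2) + (z - cnj z)"
        by (simp only: of_real_diff complex_norm_square) (simp add: algebra_simps)
      moreover have "(cmod z)\<^sup>2 < 1" using z by (simp add: abs_square_less_1)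
      ultimately show ?thesis
        by (simp only: Re_complex_div_gt_0) simp
    qed
    ultimately show ?thesis using \<beta> by simp
  qed
  ultimately show ?thesis by (simp add: class_F1_def)
qed

text \<open>
  For the extremal function the functional is the real number on the right, so equality needs only
  that this number is nonnegative; this follows from the inequality itself.
\<close>

theorem theorem4p1:
  fixes \<beta> \<mu> :: real and n m :: nat
  assumes "\<beta> < 1" and "n \<ge> 2" and "m \<ge> 2"
    and "\<mu> \<ge> max (real n * real m / ((real n + real m - 1) * (1 - \<beta>)))
                  (real n * real m / (real n + real m - 1))"
  shows "(\<forall>f a. f \<in> class_F1 \<beta> \<longrightarrow> normalized_expansion f a \<longrightarrow>
            cmod (complex_of_real \<mu> * a n * a m - a (n + m - 1))
              \<le> \<mu> * B \<beta> n * B \<beta> m - B \<beta> (n + m - 1)) \<and>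
         (\<exists>f a. f \<in> class_F1 \<beta> \<and> normalized_expansion f a \<and>
            cmod (complex_of_real \<mu> * a n * a m - a (n + m - 1))
              = \<mu> * B \<beta> n * B \<beta> m - B \<beta> (n + m - 1))"
proof (intro conjI allI impI exI)
  show "cmod (complex_of_real \<mu> * a n * a m - a (n + m - 1))
              \<le> \<mu> * B \<beta> n * B \<beta> m - B \<beta> (n + m - 1)"
    if "f \<in> class_F1 \<beta>" "normalized_expansion f a" for f a
    using F1_functional_bound[OF assms that] .
  show "F1_extremal \<beta> \<in> class_F1 \<beta>" using assms(1) by (rule F1_extremal_mem)
  show "normalized_expansion (F1_extremal \<beta>) (\<lambda>n. of_real (B \<beta> n))" by (rule F1_extremal_expansion)
  have "complex_of_real \<mu> * of_real (B \<beta> n) * of_real (B \<beta> m) - of_real (B \<beta> (n + m - 1))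
      = of_real (\<mu> * B \<beta> n * B \<beta> m - B \<beta> (n + m - 1))" by simp
  with F1_functional_bound[OF assms F1_extremal_mem[OF assms(1)] F1_extremal_expansion]
  show "cmod (complex_of_real \<mu> * of_real (B \<beta> n) * of_real (B \<beta> m) - of_real (B \<beta> (n + m - 1)))
      = \<mu> * B \<beta> n * B \<beta> m - B \<beta> (n + m - 1)"
    by (metis abs_of_nonneg norm_ge_zero norm_of_real order_trans)
qed

end
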